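(* Let $G$ be a finite simple graph on the vertex set $[n]=\{1,\dots,n\}$, and let $I_G$ be the toric ideal of the stable set polytope of $G$. If $I_G$ is generated by quadratic binomials, then $G$ has no odd stretchers as induced subgraphs; that is, for all integers $s,t,u\ge 1$, no induced subgraph of $G$ is isomorphic to the odd stretcher $G_{s,t,u}$.
   Context: A subset $S\subset[n]$ is a stable set of $G$ if no two distinct elements of $S$ are adjacent in $G$; the empty set and singletons are stable. Let $S(G)=\{S_1,\dots,S_m\}$ be the set of all stable sets of $G$. For $S\subset[n]$ put $\rho(S)=\sum_{j\in S}\mathbf{e}_j\in\mathbb{R}^n$, where $\mathbf{e}_j$ is the $j$-th unit coordinate vector. The stable set polytope of $G$ is the convex hull of $\{\rho(S_1),\dots,\rho(S_m)\}$. Let $K$ be a field, and let $K[x_1,\dots,x_m]$ and $K[t_1,\dots,t_n,s]$ be polynomial rings. The toric ideal $I_G$ of the stable set polytope of $G$ is the kernel of the $K$-algebra homomorphism $\pi_G:K[x_1,\dots,x_m]\to K[t_1,\dots,t_n,s]$ given by $\pi_G(x_i)=\mathbf{t}^{\rho(S_i)}s$, where $\mathbf{t}^{\mathbf{a}}=t_1^{a_1}\cdots t_n^{a_n}$. Convention: if $I_G=\{0\}$ (which happens exactly when $G$ is complete), then $I_G$ is also said to be generated by quadratic binomials. For integers $s,t,u\ge 1$, the odd stretcher (or prism) $G_{s,t,u}$ is the graph on the vertex set $\{i_1,\dots,i_{2s},j_1,\dots,j_{2t},k_1,\dots,k_{2u}\}$ (of $2s+2t+2u$ distinct vertices) whose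 edges are $\{i_1,j_1\},\{i_1,k_1\},\{j_1,k_1\}$; $\{i_{2s},j_{2t}\},\{i_{2s},k_{2u}\},\{j_{2t},k_{2u}\}$; $\{i_a,i_{a+1}\}$ for $1\le a\le 2s-1$; $\{j_a,j_{a+1}\}$ for $1\le a\le 2t-1$; and $\{k_a,k_{a+1}\}$ for $1\le a\le 2u-1$. *)

theory Defs
  imports "HOL-Algebra.QuotRing" "Graph_Theory.Graph_Theory" "HOL-Library.Poly_Mapping"
begin

section \<open>Polynomial rings\<close>

text \<open>
  A monomial in variables of type \<open>'v\<close> is a finitely supported exponent function, and a polynomial
  is a finitely supported map from monomials to coefficients; the multiplication of
  \<^theory>\<open>HOL-Library.Poly_Mapping\<close> on this type is the usual convolution.
\<close>

type_synonym ('v, 'k) mpoly = "('v \<Rightarrow>\<^sub>0 nat) \<Rightarrow>\<^sub>0 'k"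

definition Var :: "'v \<Rightarrow> ('v, 'k::comm_ring_1) mpoly" where
  "Var x = Poly_Mapping.single (Poly_Mapping.single x 1) 1"

definition Const :: "'k \<Rightarrow> ('v, 'k::comm_ring_1) mpoly" where
  "Const c = Poly_Mapping.single 0 c"

text \<open>\<open>poly_ring V\<close> is \<open>K[x. x \<in> V]\<close>, where \<open>K\<close> is the type \<open>'k\<close>.\<close>

definition poly_ring :: "'v set \<Rightarrow> ('v, 'k::comm_ring_1) mpoly ring" where
  "poly_ring V = \<lparr>carrier = {f. \<forall>u\<in>Poly_Mapping.keys f. Poly_Mapping.keys u \<subseteq> V},
     monoid.mult = (*), one = 1, zero = 0, add = (+)\<rparr>"

text \<open>The \<open>K\<close>-algebra homomorphism that sends each variable \<open>x\<close> to \<open>\<phi> x\<close>.\<close>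

definition poly_subst ::
    "('v \<Rightarrow> ('w, 'k::comm_ring_1) mpoly) \<Rightarrow> ('v, 'k) mpoly \<Rightarrow> ('w, 'k) mpoly" where
  "poly_subst \<phi> f =
     (\<Sum>u\<in>Poly_Mapping.keys f. Const (Poly_Mapping.lookup f u) *
        (\<Prod>x\<in>Poly_Mapping.keys u. \<phi> x ^ Poly_Mapping.lookup u x))"

definition mono_deg :: "('v \<Rightarrow>\<^sub>0 nat) \<Rightarrow> nat" where
  "mono_deg u = (\<Sum>x\<in>Poly_Mapping.keys u. Poly_Mapping.lookup u x)"

definition quadratic_binomials :: "'v set \<Rightarrow> ('v, 'k::comm_ring_1) mpoly set" where
  "quadratic_binomials V =
     {Poly_Mapping.single u 1 - Poly_Mapping.single v 1 | u v.
        u \<noteq> v \<and> Poly_Mapping.keys u \<subseteq> V \<and> Poly_Mapping.keys v \<subseteq> V \<and>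
        mono_deg u = 2 \<and> mono_deg v = 2}"

text \<open>
  \<open>B = {}\<close> is allowed and generates the zero ideal, so the zero ideal counts as generated by
  quadratic binomials (lemma \<open>zero_generated_by_quadratic_binomials\<close> below).
\<close>

definition generated_by_quadratic_binomials ::
    "'v set \<Rightarrow> ('v, 'k::comm_ring_1) mpoly set \<Rightarrow> bool" where
  "generated_by_quadratic_binomials V I \<longleftrightarrow>
     (\<exists>B \<subseteq> quadratic_binomials V. I = genideal (poly_ring V) B)"

subsection \<open>Basic properties\<close>

lemma poly_ring_simps [simp]:
  "monoid.mult (poly_ring V) = (*)" "one (poly_ring V) = 1"
  "zero (poly_ring V) = 0" "add (poly_ring V) = (+)"
  by (simp_all add: poly_ring_def)

lemma carrier_poly_ring:
  "f \<in> carrier (poly_ring V) \<longleftrightarrow>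
     (\<forall>u\<in>Poly_Mapping.keys f. Poly_Mapping.keys u \<subseteq> V)"
  by (simp add: poly_ring_def)

lemma keys_uminus_poly: "Poly_Mapping.keys (- f) = Poly_Mapping.keys (f :: ('v, 'k::comm_ring_1) mpoly)"
  by (auto simp: in_keys_iff)

lemma poly_ring_add_closed:
  "f \<in> carrier (poly_ring V) \<Longrightarrow> g \<in> carrier (poly_ring V) \<Longrightarrow> f + g \<in> carrier (poly_ring V)"
  using Poly_Mapping.keys_add[of f g] unfolding carrier_poly_ring by blast

lemma poly_ring_mult_closed:
  "f \<in> carrier (poly_ring V) \<Longrightarrow> g \<in> carrier (poly_ring V) \<Longrightarrow> f * g \<in> carrier (poly_ring V)"
  unfolding carrier_poly_ring
proof
  fix w assume f: "\<forall>u\<in>Poly_Mapping.keys f. Poly_Mapping.keys u \<subseteq> V"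
    and g: "\<forall>u\<in>Poly_Mapping.keys g. Poly_Mapping.keys u \<subseteq> V"
    and "w \<in> Poly_Mapping.keys (f * g)"
  then obtain u v where "u \<in> Poly_Mapping.keys f" "v \<in> Poly_Mapping.keys g" "w = u + v"
    using keys_mult[of f g] by blast
  with f g Poly_Mapping.keys_add[of u v] show "Poly_Mapping.keys w \<subseteq> V" by blast
qed

lemma poly_ring_cring: "cring (poly_ring V :: ('v, 'k::comm_ring_1) mpoly ring)"
proof (rule cringI)
  show "abelian_group (poly_ring V :: ('v, 'k) mpoly ring)"
  proof (rule abelian_groupI)
    fix f :: "('v, 'k) mpoly" assume "f \<in> carrier (poly_ring V)"
    then show "\<exists>g\<in>carrier (poly_ring V). g \<oplus>\<^bsub>poly_ring V\<^esub> f = \<zero>\<^bsub>poly_ring V\<^esub>"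
      by (intro bexI[of _ "- f"]) (simp_all add: carrier_poly_ring keys_uminus_poly)
  qed (simp_all add: poly_ring_add_closed add_ac, simp_all add: carrier_poly_ring)
  show "Group.comm_monoid (poly_ring V :: ('v, 'k) mpoly ring)"
    by (rule comm_monoidI)
      (simp_all add: poly_ring_mult_closed mult_ac, simp_all add: carrier_poly_ring)
qed (simp add: algebra_simps)

lemma zero_generated_by_quadratic_binomials:
  "generated_by_quadratic_binomials V {0 :: ('v, 'k::comm_ring_1) mpoly}"
proof -
  interpret cring "poly_ring V :: ('v, 'k) mpoly ring" by (rule poly_ring_cring)
  have "genideal (poly_ring V) {} = {0 :: ('v, 'k) mpoly}"
    using genideal_minimal[OF zeroideal, of "{}"]
      additive_subgroup.zero_closed[OF ideal.axioms(1)[OF genideal_ideal[of "{}"]]] by auto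
  then show ?thesis unfolding generated_by_quadratic_binomials_def by blast
qed

text \<open>\<open>poly_subst \<phi>\<close> is a \<open>K\<close>-algebra homomorphism.\<close>

lemma poly_subst_superset:
  assumes "finite A" "Poly_Mapping.keys f \<subseteq> A"
  shows "poly_subst \<phi> f =
    (\<Sum>u\<in>A. Const (Poly_Mapping.lookup f u) *
       (\<Prod>x\<in>Poly_Mapping.keys u. \<phi> x ^ Poly_Mapping.lookup u x))"
  unfolding poly_subst_def
  by (rule sum.mono_neutral_left) (use assms in \<open>auto simp: in_keys_iff Const_def\<close>)

lemma poly_subst_add: "poly_subst \<phi> (f + g) = poly_subst \<phi> f + poly_subst \<phi> g"
proof -
  let ?A = "Poly_Mapping.keys f \<union> Poly_Mapping.keys g"
  have "Poly_Mapping.keys (f + g) \<subseteq> ?A" by (rule Poly_Mapping.keys_add)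
  then show ?thesis
    by (simp add: poly_subst_superset[of ?A] lookup_add Const_def single_add algebra_simps
        sum.distrib)
qed

lemma poly_subst_zero [simp]: "poly_subst \<phi> 0 = 0"
  by (simp add: poly_subst_def)

lemma poly_subst_single:
  "poly_subst \<phi> (Poly_Mapping.single u c) =
     Const c * (\<Prod>x\<in>Poly_Mapping.keys u. \<phi> x ^ Poly_Mapping.lookup u x)"
  by (auto simp: poly_subst_def Const_def)

lemma poly_subst_Const: "poly_subst \<phi> (Const c) = Const c"
  by (simp add: Const_def[of c] poly_subst_single)

lemma poly_subst_one: "poly_subst \<phi> 1 = 1"
  using poly_subst_Const[of \<phi> 1] by (simp add: Const_def)

lemma poly_subst_Var: "poly_subst \<phi> (Var x) = \<phi> x"
  by (simp add: Var_def poly_subst_single) (simp add: Const_def)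

lemma mono_prod_add:
  fixes \<phi> :: "'v \<Rightarrow> 'a::comm_monoid_mult"
  shows "(\<Prod>x\<in>Poly_Mapping.keys (u + v). \<phi> x ^ Poly_Mapping.lookup (u + v) x) =
    (\<Prod>x\<in>Poly_Mapping.keys u. \<phi> x ^ Poly_Mapping.lookup u x) *
    (\<Prod>x\<in>Poly_Mapping.keys v. \<phi> x ^ Poly_Mapping.lookup v x)"
proof -
  let ?A = "Poly_Mapping.keys u \<union> Poly_Mapping.keys v"
  have ext: "(\<Prod>x\<in>Poly_Mapping.keys w. \<phi> x ^ Poly_Mapping.lookup w x) =
      (\<Prod>x\<in>?A. \<phi> x ^ Poly_Mapping.lookup w x)"
    if "Poly_Mapping.keys w \<subseteq> ?A" for w
    by (rule prod.mono_neutral_left) (use that in \<open>auto simp: in_keys_iff\<close>)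
  have "Poly_Mapping.keys (u + v) \<subseteq> ?A" by (rule Poly_Mapping.keys_add)
  then show ?thesis
    by (subst (1 2 3) ext) (simp_all add: lookup_add power_add prod.distrib)
qed

lemma poly_subst_sum: "poly_subst \<phi> (sum F A) = (\<Sum>a\<in>A. poly_subst \<phi> (F a))"
  by (induction A rule: infinite_finite_induct) (simp_all add: poly_subst_add)

lemma poly_eq_sum_single:
  "f = (\<Sum>u\<in>Poly_Mapping.keys f. Poly_Mapping.single u (Poly_Mapping.lookup f u))"
  by (rule poly_mapping_eqI) (auto simp: lookup_sum lookup_single when_def in_keys_iff)

lemma poly_subst_mult:
  fixes \<phi> :: "'v \<Rightarrow> ('w, 'k::comm_ring_1) mpoly"
  shows "poly_subst \<phi> (f * g) = poly_subst \<phi> f * poly_subst \<phi> g"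
proof -
  have s: "poly_subst \<phi> (Poly_Mapping.single u a * Poly_Mapping.single v b) =
      poly_subst \<phi> (Poly_Mapping.single u a) * poly_subst \<phi> (Poly_Mapping.single v b)" for u v a b
  proof -
    have "Const (a * b) = (Const a * Const b :: ('w, 'k) mpoly)"
      by (simp add: Const_def mult_single)
    then show ?thesis by (simp add: mult_single poly_subst_single mono_prod_add mult_ac)
  qed
  have "f * g = (\<Sum>u\<in>Poly_Mapping.keys f. \<Sum>v\<in>Poly_Mapping.keys g.
      Poly_Mapping.single u (Poly_Mapping.lookup f u) * Poly_Mapping.single v (Poly_Mapping.lookup g v))"
    by (subst poly_eq_sum_single[of f], subst poly_eq_sum_single[of g]) (simp add: sum_product)
  then have "poly_subst \<phi> (f * g) = (\<Sum>u\<in>Poly_Mapping.keys f. \<Sum>v\<in>Poly_Mapping.keys g.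
      poly_subst \<phi> (Poly_Mapping.single u (Poly_Mapping.lookup f u)) *
      poly_subst \<phi> (Poly_Mapping.single v (Poly_Mapping.lookup g v)))"
    by (simp add: poly_subst_sum s)
  also have "\<dots> = poly_subst \<phi> (\<Sum>u\<in>Poly_Mapping.keys f. Poly_Mapping.single u (Poly_Mapping.lookup f u)) *
      poly_subst \<phi> (\<Sum>v\<in>Poly_Mapping.keys g. Poly_Mapping.single v (Poly_Mapping.lookup g v))"
    by (simp add: poly_subst_sum sum_product)
  finally show ?thesis by (simp flip: poly_eq_sum_single)
qed

section \<open>Stable sets and the toric ideal of the stable set polytope\<close>

text \<open>A simple graph is a \<^locale>\<open>pair_graph\<close>: each edge \<open>{u, v}\<close> is the two arcs \<open>(u, v)\<close>, \<open>(v, u)\<close>.\<close>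

definition stable_sets :: "'a pair_pre_digraph \<Rightarrow> 'a set set" where
  "stable_sets G = {S. S \<subseteq> pverts G \<and> (\<forall>u\<in>S. \<forall>v\<in>S. u \<noteq> v \<longrightarrow> (u, v) \<notin> parcs G)}"

text \<open>
  The vertex of the stable set polytope given by \<open>S\<close>. It has non-negative integer coordinates and
  serves as an exponent vector only, hence the type.
\<close>

definition rho :: "'a set \<Rightarrow> ('a \<Rightarrow>\<^sub>0 nat)" where
  "rho S = (\<Sum>j\<in>S. Poly_Mapping.single j 1)"

datatype 'a tvar = t_var 'a | s_var

definition t_power :: "('a \<Rightarrow>\<^sub>0 nat) \<Rightarrow> ('a tvar, 'k::comm_ring_1) mpoly" where
  "t_power a = (\<Prod>j\<in>Poly_Mapping.keys a. Var (t_var j) ^ Poly_Mapping.lookup a j)"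

text \<open>
  The variables \<open>x\<^sub>1, \<dots>, x\<^sub>m\<close> are indexed by the stable sets themselves instead of by an
  enumeration \<open>S\<^sub>1, \<dots>, S\<^sub>m\<close> of them.
\<close>

definition toric_map :: "('a set, 'k::comm_ring_1) mpoly \<Rightarrow> ('a tvar, 'k) mpoly" where
  "toric_map = poly_subst (\<lambda>S. t_power (rho S) * Var s_var)"

definition toric_ideal :: "'a pair_pre_digraph \<Rightarrow> ('a set, 'k::comm_ring_1) mpoly set" where
  "toric_ideal G =
     a_kernel (poly_ring (stable_sets G)) (poly_ring (insert s_var (t_var ` pverts G))) toric_map"

lemma Var_in_poly_ring: "x \<in> V \<Longrightarrow> Var x \<in> carrier (poly_ring V)"
  by (simp add: Var_def carrier_poly_ring)

lemma poly_subst_ring_hom: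
  fixes \<phi> :: "'v \<Rightarrow> ('w, 'k::comm_ring_1) mpoly"
  assumes \<phi>: "\<And>x. x \<in> V \<Longrightarrow> \<phi> x \<in> carrier (poly_ring W)"
  shows "poly_subst \<phi> \<in> ring_hom (poly_ring V) (poly_ring W)"
proof (rule ring_hom_memI)
  interpret W: cring "poly_ring W :: ('w, 'k) mpoly ring" by (rule poly_ring_cring)
  have one: "(1 :: ('w, 'k) mpoly) \<in> carrier (poly_ring W)"
    and zero: "(0 :: ('w, 'k) mpoly) \<in> carrier (poly_ring W)"
    by (simp_all add: carrier_poly_ring)
  have pow: "f ^ n \<in> carrier (poly_ring W)"
    if "f \<in> carrier (poly_ring W)" for f :: "('w, 'k) mpoly" and n
    by (induction n) (simp_all add: one that poly_ring_mult_closed)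
  have prod: "prod F A \<in> carrier (poly_ring W)" if "\<And>a. a \<in> A \<Longrightarrow> F a \<in> carrier (poly_ring W)"
    for F :: "'b \<Rightarrow> ('w, 'k) mpoly" and A
    using that by (induction A rule: infinite_finite_induct)
      (simp_all add: one poly_ring_mult_closed)
  have sum: "sum F A \<in> carrier (poly_ring W)" if "\<And>a. a \<in> A \<Longrightarrow> F a \<in> carrier (poly_ring W)"
    for F :: "'b \<Rightarrow> ('w, 'k) mpoly" and A
    using that by (induction A rule: infinite_finite_induct)
      (simp_all add: zero poly_ring_add_closed)
  have const: "Const c \<in> carrier (poly_ring W)" for c :: 'k
    by (simp add: carrier_poly_ring Const_def)
  fix f :: "('v, 'k) mpoly" assume "f \<in> carrier (poly_ring V)"
  then show "poly_subst \<phi> f \<in> carrier (poly_ring W)"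
    unfolding poly_subst_def
    by (intro sum poly_ring_mult_closed const prod pow \<phi>) (auto simp: carrier_poly_ring)
qed (simp_all add: poly_subst_add poly_subst_mult poly_subst_one)

lemma toric_map_Var: "toric_map (Var S) = t_power (rho S) * Var s_var"
  by (simp add: toric_map_def poly_subst_Var)

lemma toric_ideal_iff:
  "f \<in> toric_ideal G \<longleftrightarrow> f \<in> carrier (poly_ring (stable_sets G)) \<and> toric_map f = 0"
  by (simp add: toric_ideal_def a_kernel_def kernel_def)

section \<open>Odd stretchers\<close>

datatype stretcher_vertex = vi nat | vj nat | vk nat

definition odd_stretcher :: "nat \<Rightarrow> nat \<Rightarrow> nat \<Rightarrow> stretcher_vertex pair_pre_digraph" where
  "odd_stretcher s t u =
     (let E = {(vi 1, vj 1), (vi 1, vk 1), (vj 1, vk 1),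
               (vi (2*s), vj (2*t)), (vi (2*s), vk (2*u)), (vj (2*t), vk (2*u))}
            \<union> {(vi a, vi (a + 1)) | a. 1 \<le> a \<and> a \<le> 2*s - 1}
            \<union> {(vj a, vj (a + 1)) | a. 1 \<le> a \<and> a \<le> 2*t - 1}
            \<union> {(vk a, vk (a + 1)) | a. 1 \<le> a \<and> a \<le> 2*u - 1}
      in \<lparr>pverts = vi ` {1..2*s} \<union> vj ` {1..2*t} \<union> vk ` {1..2*u}, parcs = E \<union> E\<inverse>\<rparr>)"

end

theory Submission
  imports Defs
begin

text \<open>
  A monomial in the stable set variables is a multiset of stable sets. Two monomials have the same
  image under the toric map exactly when they have the same degree and cover every vertex equally
  often, so monomials of one fibre are the colourings, by unordered stable classes, of one weighted
  vertex set, and a quadratic binomial in the toric ideal recolours the union of two classes.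

  In a stretcher with paths \<open>p\<close>, \<open>q\<close>, \<open>r\<close> of even length, give the last vertex of each path
  weight 1, every other even position weight 2 and every odd position weight 1. In a colouring by
  three stable sets of this weight, the weights of two consecutive path vertices other than the
  last add up to 3, so all odd positions of a path carry one colour and all even positions but the
  last carry the other two. Only the three colours at each end remain to be chosen; the
  two triangles and the fact that a path ends in a colour different from its first one force a
  permutation of three paths without fixed point. There are two of these, the 3-cycles, and they
  give two cubic monomials \<open>X\<close> and \<open>Y\<close>; their classes are the sets \<open>colour_class\<close> of the rotations
  of \<open>(p, q, r)\<close> and of its reflections.

  The binomial \<open>X - Y\<close> lies in the toric ideal. Any two of the classes of \<open>X\<close> differ in a
  connected subgraph, in fact a path (\<open>symmetric_difference_connected\<close>), so their multiset union
  has no other decomposition into two stable sets (\<open>stable_pair_unique\<close>). Hence no term of a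
  quadratic binomial of the toric ideal divides \<open>X\<close>. The polynomials none of whose monomials
  divides \<open>X\<close> form an ideal (\<open>nondivisors_ideal\<close>); it contains all quadratic binomials of the
  toric ideal, but not \<open>X - Y\<close>. That \<open>X\<close> and \<open>Y\<close> are the only members of their fibre is not
  needed.
\<close>

section \<open>Ideals that avoid a monomial\<close>

lemma keys_binomial:
  "Poly_Mapping.keys (Poly_Mapping.single m a - Poly_Mapping.single m' (b :: 'k::ab_group_add)) \<subseteq> {m, m'}"
  by (auto simp: in_keys_iff lookup_minus lookup_single when_def split: if_splits)

lemma quadratic_binomials_in_carrier: "quadratic_binomials V \<subseteq> carrier (poly_ring V)"
  unfolding quadratic_binomials_def poly_ring_def
  using keys_binomial by fastforce

text \<open>The polynomials none of whose monomials divides \<open>u\<close>.\<close>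

lemma nondivisors_ideal:
  "ideal {f \<in> carrier (poly_ring V). \<forall>m\<in>Poly_Mapping.keys f. \<forall>w. m + w \<noteq> u}
     (poly_ring V :: ('v, 'k::comm_ring_1) mpoly ring)" (is "ideal ?J ?R")
proof -
  interpret R: cring ?R by (rule poly_ring_cring)
  have add: "f + g \<in> ?J" if "f \<in> ?J" "g \<in> ?J" for f g
    using that Poly_Mapping.keys_add[of f g] by (auto simp: poly_ring_add_closed)
  have mult: "f * g \<in> ?J" if f: "f \<in> ?J" and g: "g \<in> carrier ?R" for f g
  proof -
    have "m + w \<noteq> u" if "m \<in> Poly_Mapping.keys (f * g)" for m w
    proof -
      obtain a b where "a \<in> Poly_Mapping.keys f" "m = a + b"
        using \<open>m \<in> _\<close> keys_mult[of f g] by blast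
      then show ?thesis using f by (auto simp: add.assoc)
    qed
    then show ?thesis using f g by (auto simp: poly_ring_mult_closed)
  qed
  have minus: "\<ominus>\<^bsub>?R\<^esub> f = - f" if "f \<in> carrier ?R" for f
    using that by (intro R.minus_equality) (auto simp: carrier_poly_ring keys_uminus_poly)
  show ?thesis
  proof (rule idealI[OF R.ring_axioms])
    show "subgroup ?J (add_monoid ?R)"
    proof (rule R.add.subgroupI)
      show "?J \<noteq> {}"
      proof -
        have "0 \<in> ?J" by (simp add: carrier_poly_ring)
        then show ?thesis by blast
      qed
      fix f assume f: "f \<in> ?J"
      then have "- f \<in> ?J" by (auto simp: carrier_poly_ring keys_uminus_poly)
      with f show "\<ominus>\<^bsub>?R\<^esub> f \<in> ?J" using minus by auto
      fix g assume "g \<in> ?J"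
      with f show "f \<oplus>\<^bsub>?R\<^esub> g \<in> ?J"
        using add by (simp only: poly_ring_simps)
    qed blast
  next
    fix f g assume f: "f \<in> ?J" and g: "g \<in> carrier ?R"
    show "f \<otimes>\<^bsub>?R\<^esub> g \<in> ?J" "g \<otimes>\<^bsub>?R\<^esub> f \<in> ?J"
      using mult[OF f g] mult.commute[of g f] by (simp_all only: poly_ring_simps)
  qed
qed

lemma monomial_notin_keys_genideal:
  fixes f :: "('v, 'k::comm_ring_1) mpoly"
  assumes B: "B \<subseteq> carrier (poly_ring V)"
    and f: "f \<in> genideal (poly_ring V) B"
    and nd: "\<And>b m w. b \<in> B \<Longrightarrow> m \<in> Poly_Mapping.keys b \<Longrightarrow> m + w \<noteq> u"
  shows "u \<notin> Poly_Mapping.keys f"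
proof
  assume u: "u \<in> Poly_Mapping.keys f"
  interpret R: cring "poly_ring V :: ('v, 'k) mpoly ring" by (rule poly_ring_cring)
  have "genideal (poly_ring V) B \<subseteq>
      {f \<in> carrier (poly_ring V). \<forall>m\<in>Poly_Mapping.keys f. \<forall>w. m + w \<noteq> u}"
    by (rule R.genideal_minimal[OF nondivisors_ideal]) (use B nd in auto)
  with f u have "u + 0 \<noteq> u" by blast
  then show False by simp
qed

section \<open>Quadratic monomials and their images\<close>

lemma mono_deg_superset:
  assumes "finite A" "Poly_Mapping.keys m \<subseteq> A"
  shows "mono_deg m = (\<Sum>x\<in>A. Poly_Mapping.lookup m x)"
  unfolding mono_deg_def by (rule sum.mono_neutral_left) (use assms in \<open>auto simp: in_keys_iff\<close>)

lemma mono_deg_add: "mono_deg (m + m') = mono_deg m + mono_deg m'"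
proof -
  let ?A = "Poly_Mapping.keys m \<union> Poly_Mapping.keys m'"
  have "Poly_Mapping.keys (m + m') \<subseteq> ?A" by (rule Poly_Mapping.keys_add)
  then show ?thesis by (simp add: mono_deg_superset[of ?A] lookup_add sum.distrib)
qed

lemma mono_deg_single: "mono_deg (Poly_Mapping.single x k) = k"
  by (simp add: mono_deg_def)

lemma mono_deg_SucE:
  assumes "mono_deg m = Suc k"
  obtains x m' where "m = Poly_Mapping.single x 1 + m'" "mono_deg m' = k"
proof -
  have "m \<noteq> 0" using assms by (auto simp: mono_deg_def)
  then obtain x where x: "Poly_Mapping.lookup m x \<noteq> 0"
    by (metis poly_mapping_eqI lookup_zero)
  have m: "m = Poly_Mapping.single x 1 + (m - Poly_Mapping.single x 1)"
    by (rule poly_mapping_eqI) (use x in \<open>auto simp: lookup_add lookup_minus lookup_single when_def\<close>)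
  with assms have "mono_deg (m - Poly_Mapping.single x 1) = k"
    by (metis mono_deg_add mono_deg_single plus_1_eq_Suc Suc_inject)
  with m show ?thesis using that by blast
qed

lemma quadratic_monomialE:
  assumes "mono_deg m = 2"
  obtains x y where "m = Poly_Mapping.single x 1 + Poly_Mapping.single y 1"
proof -
  obtain x m' where m: "m = Poly_Mapping.single x 1 + m'" and "mono_deg m' = Suc 0"
    using assms mono_deg_SucE[of m "Suc 0"] by (auto simp: numeral_2_eq_2)
  then obtain y m'' where m': "m' = Poly_Mapping.single y 1 + m''" "mono_deg m'' = 0"
    using mono_deg_SucE by metis
  then have "m'' = 0" by (auto simp: mono_deg_def in_keys_iff intro!: poly_mapping_eqI)
  with m m' that show ?thesis by simp
qed

text \<open>The exponent of the squarefree monomial in the variables \<open>t\<^sub>j\<close>, \<open>j \<in> S\<close>.\<close>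

definition incidence_exponent :: "'a set \<Rightarrow> ('a tvar \<Rightarrow>\<^sub>0 nat)" where
  "incidence_exponent S = (\<Sum>j\<in>S. Poly_Mapping.single (t_var j) 1)"

text \<open>
  The exponent of the image of the variable of a finite set \<open>S\<close>
  (\<open>toric_map_variable\<close>).
\<close>

definition toric_exponent :: "'a set \<Rightarrow> ('a tvar \<Rightarrow>\<^sub>0 nat)" where
  "toric_exponent S = incidence_exponent S + Poly_Mapping.single s_var 1"

lemma incidence_exponent_union:
  "finite A \<Longrightarrow> finite B \<Longrightarrow> A \<inter> B = {} \<Longrightarrow>
    incidence_exponent (A \<union> B) = incidence_exponent A + incidence_exponent B"
  unfolding incidence_exponent_def by (rule sum.union_disjoint)

lemma lookup_rho: "finite S \<Longrightarrow> Poly_Mapping.lookup (rho S) x = of_bool (x \<in> S)"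
  by (simp add: rho_def lookup_sum lookup_single when_def)

lemma lookup_toric_exponent:
  "finite S \<Longrightarrow> Poly_Mapping.lookup (toric_exponent S) (t_var x) = of_bool (x \<in> S)"
  by (simp add: toric_exponent_def incidence_exponent_def lookup_add lookup_sum lookup_single when_def)

lemma prod_single_one:
  "(\<Prod>j\<in>A. Poly_Mapping.single (h j) (1::'k::comm_ring_1)) =
     Poly_Mapping.single (\<Sum>j\<in>A. h j :: 'b \<Rightarrow>\<^sub>0 nat) 1"
  by (induction A rule: infinite_finite_induct) (simp_all add: mult_single)

lemma toric_map_variable:
  assumes "finite S"
  shows "toric_map (Var S :: ('a set, 'k::comm_ring_1) mpoly) = Poly_Mapping.single (toric_exponent S) 1"
proof -
  have "Poly_Mapping.keys (rho S) = S" using assms by (auto simp: in_keys_iff lookup_rho)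
  then have "t_power (rho S) = (\<Prod>j\<in>S. Var (t_var j) :: ('a tvar, 'k) mpoly)"
    using assms by (simp add: t_power_def lookup_rho)
  also have "\<dots> = Poly_Mapping.single (incidence_exponent S) 1"
    unfolding Var_def incidence_exponent_def by (rule prod_single_one)
  finally show ?thesis
    by (simp add: toric_map_Var Var_def[of s_var] mult_single toric_exponent_def)
qed

lemma toric_map_add_exponents:
  "toric_map (Poly_Mapping.single (m + m') (1::'k::comm_ring_1)) =
     toric_map (Poly_Mapping.single m 1) * toric_map (Poly_Mapping.single m' 1)"
proof -
  have "Poly_Mapping.single (m + m') (1::'k) = Poly_Mapping.single m 1 * Poly_Mapping.single m' 1"
    by (simp add: mult_single)
  then show ?thesis by (simp add: toric_map_def poly_subst_mult)
qed

lemma toric_map_single_variable: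
  assumes "finite S"
  shows "toric_map (Poly_Mapping.single (Poly_Mapping.single S 1) (1::'k::comm_ring_1)) =
    Poly_Mapping.single (toric_exponent S) 1"
  using toric_map_variable[OF assms, where 'k='k] by (simp add: Var_def)

lemma toric_map_diff: "toric_map (f - g) = toric_map f - toric_map g"
proof -
  have "toric_map f = toric_map (f - g) + toric_map g"
    unfolding toric_map_def by (simp flip: poly_subst_add)
  then show ?thesis by simp
qed

lemma squarefree_divisor_of_degree_2:
  assumes "X \<noteq> Y" "X \<noteq> Z" "Y \<noteq> Z"
    and eq: "Poly_Mapping.single A (1::nat) + Poly_Mapping.single B 1 + w =
      Poly_Mapping.single X 1 + Poly_Mapping.single Y 1 + Poly_Mapping.single Z 1"
  shows "A \<in> {X, Y, Z}" "B \<in> {X, Y, Z}" "A \<noteq> B"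
  using assms(1-3) arg_cong[OF eq, of "\<lambda>e. Poly_Mapping.lookup e A"]
    arg_cong[OF eq, of "\<lambda>e. Poly_Mapping.lookup e B"]
  by (auto simp: lookup_add lookup_single when_def split: if_splits)

section \<open>Decompositions into two stable sets\<close>

text \<open>
  Connectedness of the subgraph induced on \<open>D\<close>: a property that is constant along the edges inside
  \<open>D\<close> is constant on \<open>D\<close>. The empty set counts as connected.
\<close>

definition connected_on :: "'a pair_pre_digraph \<Rightarrow> 'a set \<Rightarrow> bool" where
  "connected_on G D \<longleftrightarrow>
     (\<forall>P :: 'a \<Rightarrow> bool. (\<forall>x\<in>D. \<forall>y\<in>D. (x, y) \<in> parcs G \<longrightarrow> P x = P y) \<longrightarrow>
        (\<forall>x\<in>D. \<forall>y\<in>D. P x = P y))"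

lemma stable_setsD: "S \<in> stable_sets G \<Longrightarrow> x \<in> S \<Longrightarrow> y \<in> S \<Longrightarrow> x \<noteq> y \<Longrightarrow> (x, y) \<notin> parcs G"
  by (auto simp: stable_sets_def)

text \<open>
  The multiset union of \<open>S\<close> and \<open>T\<close> determines their intersection and their symmetric difference
  \<open>D\<close>. Along an edge inside \<open>D\<close>, membership in \<open>S\<close> changes, and so does membership in \<open>A\<close>; hence
  \<open>A\<close> agrees either with \<open>S\<close> or with \<open>T\<close> on all of \<open>D\<close>.
\<close>

lemma stable_pair_unique:
  assumes G: "pair_graph G"
    and st: "S \<in> stable_sets G" "T \<in> stable_sets G" "A \<in> stable_sets G" "B \<in> stable_sets G"
    and cnt: "\<And>x. of_bool (x \<in> A) + of_bool (x \<in> B) = (of_bool (x \<in> S) + of_bool (x \<in> T) :: nat)"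
    and conn: "connected_on G ((S - T) \<union> (T - S))"
  shows "(A = S \<and> B = T) \<or> (A = T \<and> B = S)"
proof -
  interpret pair_graph G by fact
  let ?D = "(S - T) \<union> (T - S)"
  have both: "x \<in> A \<and> x \<in> B \<longleftrightarrow> x \<in> S \<and> x \<in> T" for x
    using cnt[of x] by (auto simp: of_bool_def split: if_splits)
  have either: "x \<in> A \<or> x \<in> B \<longleftrightarrow> x \<in> S \<or> x \<in> T" for x
    using cnt[of x] by (auto simp: of_bool_def split: if_splits)
  have edge: "(x \<in> A \<longleftrightarrow> x \<in> S) = (y \<in> A \<longleftrightarrow> y \<in> S)"
    if D: "x \<in> ?D" "y \<in> ?D" and e: "(x, y) \<in> parcs G" for x y
  proof -
    have ne: "x \<noteq> y" using e pair_no_loops[of "(x,y)"] by auto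
    have "\<not> (x \<in> U \<and> y \<in> U)" if "U \<in> stable_sets G" for U
      using stable_setsD[OF that _ _ ne] e by blast
    from this[OF st(1)] this[OF st(2)] this[OF st(3)] this[OF st(4)] D
      both[of x] both[of y] either[of x] either[of y]
    show ?thesis by blast
  qed
  have c: "\<forall>x\<in>?D. \<forall>y\<in>?D. (x \<in> A \<longleftrightarrow> x \<in> S) = (y \<in> A \<longleftrightarrow> y \<in> S)"
    using conn[unfolded connected_on_def, rule_format, of "\<lambda>x. x \<in> A \<longleftrightarrow> x \<in> S"] edge by blast
  show ?thesis
  proof (cases "\<forall>x\<in>?D. x \<in> A \<longleftrightarrow> x \<in> S")
    case True
    then have "A = S \<and> B = T" using both either by blast
    then show ?thesis ..
  next
    case False
    then have "\<forall>x\<in>?D. \<not> (x \<in> A \<longleftrightarrow> x \<in> S)" using c by blast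
    then have "A = T \<and> B = S" using both either by blast
    then show ?thesis ..
  qed
qed

lemma disjoint_subsets: "C \<subseteq> A \<Longrightarrow> D \<subseteq> B \<Longrightarrow> A \<inter> B = {} \<Longrightarrow> C \<inter> D = {}"
  by blast

lemma disjoint_notin: "x \<in> A \<Longrightarrow> A \<inter> B = {} \<Longrightarrow> C \<subseteq> B \<Longrightarrow> x \<notin> C"
  by blast

section \<open>Embedded stretchers and their colourings\<close>

text \<open>
  The sequences \<open>p\<close>, \<open>q\<close>, \<open>r\<close> list, from index 1 on, the three paths of an odd stretcher that is
  an induced subgraph of \<open>G\<close>. The assumptions are stated symmetrically, so that rotating or
  reflecting the triple of paths gives another instance.
\<close>

locale embedded_stretcher =
  fixes G :: "'a pair_pre_digraph" and p q r :: "nat \<Rightarrow> 'a" and s t u :: nat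
  assumes graph: "pair_graph G"
    and pos: "s \<ge> 1" "t \<ge> 1" "u \<ge> 1"
    and verts: "p ` {1..2*s} \<subseteq> pverts G" "q ` {1..2*t} \<subseteq> pverts G" "r ` {1..2*u} \<subseteq> pverts G"
    and inj: "inj_on p {1..2*s}" "inj_on q {1..2*t}" "inj_on r {1..2*u}"
    and disj: "p ` {1..2*s} \<inter> q ` {1..2*t} = {}" "q ` {1..2*t} \<inter> r ` {1..2*u} = {}"
      "r ` {1..2*u} \<inter> p ` {1..2*s} = {}"
    and pp: "\<And>a b. a \<in> {1..2*s} \<Longrightarrow> b \<in> {1..2*s} \<Longrightarrow> (p a, p b) \<in> parcs G \<longleftrightarrow> b = a + 1 \<or> a = b + 1"
    and qq: "\<And>a b. a \<in> {1..2*t} \<Longrightarrow> b \<in> {1..2*t} \<Longrightarrow> (q a, q b) \<in> parcs G \<longleftrightarrow> b = a + 1 \<or> a = b + 1"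
    and rr: "\<And>a b. a \<in> {1..2*u} \<Longrightarrow> b \<in> {1..2*u} \<Longrightarrow> (r a, r b) \<in> parcs G \<longleftrightarrow> b = a + 1 \<or> a = b + 1"
    and pq: "\<And>a b. a \<in> {1..2*s} \<Longrightarrow> b \<in> {1..2*t} \<Longrightarrow>
      (p a, q b) \<in> parcs G \<longleftrightarrow> a = 1 \<and> b = 1 \<or> a = 2*s \<and> b = 2*t"
    and qr: "\<And>a b. a \<in> {1..2*t} \<Longrightarrow> b \<in> {1..2*u} \<Longrightarrow>
      (q a, r b) \<in> parcs G \<longleftrightarrow> a = 1 \<and> b = 1 \<or> a = 2*t \<and> b = 2*u"
    and rp: "\<And>a b. a \<in> {1..2*u} \<Longrightarrow> b \<in> {1..2*s} \<Longrightarrow>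
      (r a, p b) \<in> parcs G \<longleftrightarrow> a = 1 \<and> b = 1 \<or> a = 2*u \<and> b = 2*s"
begin

lemma arc_sym: "(x, y) \<in> parcs G \<longleftrightarrow> (y, x) \<in> parcs G"
proof -
  interpret pair_graph G by (rule graph)
  show ?thesis using pair_sym_arcs by (auto simp: symmetric_def dest: symD)
qed

lemma qp:
  "b \<in> {1..2*t} \<Longrightarrow> a \<in> {1..2*s} \<Longrightarrow>
    (q b, p a) \<in> parcs G \<longleftrightarrow> b = 1 \<and> a = 1 \<or> b = 2*t \<and> a = 2*s"
  using pq[of a b] arc_sym[of "q b"] by blast

lemma rq:
  "b \<in> {1..2*u} \<Longrightarrow> a \<in> {1..2*t} \<Longrightarrow>
    (r b, q a) \<in> parcs G \<longleftrightarrow> b = 1 \<and> a = 1 \<or> b = 2*u \<and> a = 2*t"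
  using qr[of a b] arc_sym[of "r b"] by blast

lemma pr:
  "b \<in> {1..2*s} \<Longrightarrow> a \<in> {1..2*u} \<Longrightarrow>
    (p b, r a) \<in> parcs G \<longleftrightarrow> b = 1 \<and> a = 1 \<or> b = 2*s \<and> a = 2*u"
  using rp[of a b] arc_sym[of "p b"] by blast

lemma rotate: "embedded_stretcher G q r p t u s"
  by (rule embedded_stretcher.intro; fact graph pos verts inj disj pp qq rr pq qr rp)

lemma disj':
  "p ` {1..2*s} \<inter> r ` {1..2*u} = {}" "r ` {1..2*u} \<inter> q ` {1..2*t} = {}"
  "q ` {1..2*t} \<inter> p ` {1..2*s} = {}"
  using disj by (simp_all add: Int_commute)

lemma reflect: "embedded_stretcher G p r q s u t"
  by (rule embedded_stretcher.intro; fact graph pos verts inj disj' pp qq rr pr rq qp)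

end

text \<open>
  The class of the colour that starts \<open>p\<close> and ends \<open>r\<close>: it occupies the odd positions of \<open>p\<close> and
  the even positions of \<open>q\<close> and \<open>r\<close>, except for the last vertex of \<open>q\<close>. A rotation
  of \<open>(p, q, r)\<close> gives the other classes of the same colouring, and the odd permutations give those
  of the second colouring.
\<close>

definition colour_class :: "(nat \<Rightarrow> 'a) \<Rightarrow> (nat \<Rightarrow> 'a) \<Rightarrow> (nat \<Rightarrow> 'a) \<Rightarrow> nat \<Rightarrow> nat \<Rightarrow> nat \<Rightarrow> 'a set" where
  "colour_class p q r s t u =
     p ` {a \<in> {1..2*s}. odd a} \<union> q ` {b \<in> {1..<2*t}. even b} \<union> r ` {c \<in> {1..2*u}. even c}"

context embedded_stretcher
begin

lemma colour_class_parts: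
  "p ` {a \<in> {1..2*s}. odd a} \<subseteq> p ` {1..2*s}"
  "q ` {b \<in> {1..<2*t}. even b} \<subseteq> q ` {1..2*t}"
  "r ` {c \<in> {1..2*u}. even c} \<subseteq> r ` {1..2*u}"
  by auto

lemma colour_class_subset:
  "colour_class p q r s t u \<subseteq> p ` {1..2*s} \<union> q ` {1..2*t} \<union> r ` {1..2*u}"
  unfolding colour_class_def by (intro Un_mono colour_class_parts)

lemma colour_class_iff:
  "a \<in> {1..2*s} \<Longrightarrow> p a \<in> colour_class p q r s t u \<longleftrightarrow> odd a"
  "b \<in> {1..2*t} \<Longrightarrow> q b \<in> colour_class p q r s t u \<longleftrightarrow> even b \<and> b < 2*t"
  "c \<in> {1..2*u} \<Longrightarrow> r c \<in> colour_class p q r s t u \<longleftrightarrow> even c"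
proof -
  assume a: "a \<in> {1..2*s}"
  have "p a \<in> p ` {a \<in> {1..2*s}. odd a} \<longleftrightarrow> a \<in> {a \<in> {1..2*s}. odd a}"
    by (rule inj_on_image_mem_iff[OF inj(1) a]) auto
  moreover have "p a \<notin> q ` {b \<in> {1..<2*t}. even b}" "p a \<notin> r ` {c \<in> {1..2*u}. even c}"
    by (rule disjoint_notin[OF imageI[OF a]], rule disj, rule colour_class_parts)
      (rule disjoint_notin[OF imageI[OF a]], rule disj', rule colour_class_parts)
  ultimately show "p a \<in> colour_class p q r s t u \<longleftrightarrow> odd a"
    using a by (simp add: colour_class_def)
next
  assume b: "b \<in> {1..2*t}"
  have "q b \<in> q ` {b \<in> {1..<2*t}. even b} \<longleftrightarrow> b \<in> {b \<in> {1..<2*t}. even b}"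
    by (rule inj_on_image_mem_iff[OF inj(2) b]) auto
  moreover have "q b \<notin> p ` {a \<in> {1..2*s}. odd a}" "q b \<notin> r ` {c \<in> {1..2*u}. even c}"
    by (rule disjoint_notin[OF imageI[OF b]], rule disj', rule colour_class_parts)
      (rule disjoint_notin[OF imageI[OF b]], rule disj, rule colour_class_parts)
  ultimately show "q b \<in> colour_class p q r s t u \<longleftrightarrow> even b \<and> b < 2*t"
    using b by (auto simp add: colour_class_def)
next
  assume c: "c \<in> {1..2*u}"
  have "r c \<in> r ` {c \<in> {1..2*u}. even c} \<longleftrightarrow> c \<in> {c \<in> {1..2*u}. even c}"
    by (rule inj_on_image_mem_iff[OF inj(3) c]) auto
  moreover have "r c \<notin> p ` {a \<in> {1..2*s}. odd a}" "r c \<notin> q ` {b \<in> {1..<2*t}. even b}"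
    by (rule disjoint_notin[OF imageI[OF c]], rule disj, rule colour_class_parts)
      (rule disjoint_notin[OF imageI[OF c]], rule disj', rule colour_class_parts)
  ultimately show "r c \<in> colour_class p q r s t u \<longleftrightarrow> even c"
    using c by (simp add: colour_class_def)
qed

lemma colour_classE:
  assumes "x \<in> colour_class p q r s t u"
  obtains (p) a where "a \<in> {1..2*s}" "odd a" "x = p a"
    | (q) b where "b \<in> {1..2*t}" "even b" "b < 2*t" "x = q b"
    | (r) c where "c \<in> {1..2*u}" "even c" "x = r c"
  using assms unfolding colour_class_def by (elim UnE imageE) auto

lemma colour_class_stable: "colour_class p q r s t u \<in> stable_sets G"
proof -
  have sub: "colour_class p q r s t u \<subseteq> pverts G"
    unfolding colour_class_def
    by (intro Un_least; rule order_trans, rule colour_class_parts, rule verts)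
  have "(x, y) \<notin> parcs G" if "x \<in> colour_class p q r s t u" "y \<in> colour_class p q r s t u" for x y
  proof
    assume e: "(x, y) \<in> parcs G"
    from that(1) show False
    proof (cases rule: colour_classE)
      case (p a)
      note x = this
      from that(2) show False
      proof (cases rule: colour_classE)
        case (p a')
        then show False using e x pp[of a a'] by auto
      next
        case (q b')
        then show False using e x pq[of a b'] by auto
      next
        case (r c')
        then show False using e x pr[of a c'] by auto
      qed
    next
      case (q b)
      note x = this
      from that(2) show False
      proof (cases rule: colour_classE)
        case (p a')
        then show False using e x qp[of b a'] by auto
      next
        case (q b')
        then show False using e x qq[of b b'] by auto
      next
        case (r c')
        then show False using e x qr[of b c'] by auto
      qed
    next
      case (r c)
      note x = this
      from that(2) show False
      proof (cases rule: colour_classE)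
        case (p a')
        then show False using e x rp[of c a'] by auto
      next
        case (q b')
        then show False using e x rq[of c b'] by auto
      next
        case (r c')
        then show False using e x rr[of c c'] by auto
      qed
    qed
  qed
  with sub show ?thesis by (auto simp: stable_sets_def)
qed

lemma toric_exponent_colour_class:
  "toric_exponent (colour_class p q r s t u) =
     incidence_exponent (p ` {a \<in> {1..2*s}. odd a}) +
     incidence_exponent (q ` {b \<in> {1..<2*t}. even b}) +
     incidence_exponent (r ` {c \<in> {1..2*u}. even c}) + Poly_Mapping.single s_var 1"
proof -
  let ?P = "p ` {a \<in> {1..2*s}. odd a}" and ?Q = "q ` {b \<in> {1..<2*t}. even b}"
    and ?R = "r ` {c \<in> {1..2*u}. even c}"
  have "?P \<inter> ?Q = {}" "?P \<inter> ?R = {}" "?Q \<inter> ?R = {}"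
    by (rule disjoint_subsets, rule colour_class_parts, rule colour_class_parts, fact disj disj')+
  then have "?P \<inter> ?Q = {}" "(?P \<union> ?Q) \<inter> ?R = {}" by (simp_all only: Int_Un_distrib2 Un_empty)
  then show ?thesis
    unfolding toric_exponent_def colour_class_def
    using incidence_exponent_union[of ?P ?Q] incidence_exponent_union[of "?P \<union> ?Q" ?R] by simp
qed

text \<open>
  The two classes differ in the path \<open>q (2*t-1), \<dots>, q 1, p 1, \<dots>, p (2*s), r (2*u)\<close>; at the other
  vertices of \<open>q\<close> and \<open>r\<close> they agree.
\<close>

lemma symmetric_difference_connected:
  defines "S \<equiv> colour_class p q r s t u" and "T \<equiv> colour_class q r p t u s"
  shows "connected_on G ((S - T) \<union> (T - S))"
proof -
  interpret rot: embedded_stretcher G q r p t u s by (rule rotate)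
  let ?D = "(S - T) \<union> (T - S)"
  have pD: "p a \<in> ?D" if "a \<in> {1..2*s}" for a
    using colour_class_iff(1)[OF that] rot.colour_class_iff(3)[OF that] by (auto simp: S_def T_def)
  have qD: "q b \<in> ?D \<longleftrightarrow> b < 2*t" if "b \<in> {1..2*t}" for b
  proof -
    have "odd b \<Longrightarrow> b < 2*t" using that by (cases "b = 2*t") auto
    then show ?thesis
      using colour_class_iff(2)[OF that] rot.colour_class_iff(1)[OF that] by (auto simp: S_def T_def)
  qed
  have rD: "r c \<in> ?D \<longleftrightarrow> c = 2*u" if "c \<in> {1..2*u}" for c
    using colour_class_iff(3)[OF that] rot.colour_class_iff(2)[OF that] that
    by (auto simp: S_def T_def)
  have "P x = P (p 1)"
    if P: "\<forall>x\<in>?D. \<forall>y\<in>?D. (x, y) \<in> parcs G \<longrightarrow> P x = P y" and x: "x \<in> ?D" for P :: "'a \<Rightarrow> bool" and x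
  proof -
    have p: "P (p a) = P (p 1)" if "1 \<le> a" "a \<le> 2*s" for a
      using that
    proof (induction a rule: dec_induct)
      case (step a)
      then have "P (p (Suc a)) = P (p a)"
        using P[rule_format, OF pD pD, of "Suc a" a] pp[of "Suc a" a] by auto
      with step show ?case by simp
    qed simp
    have q: "P (q b) = P (p 1)" if "1 \<le> b" "b < 2*t" for b
      using that
    proof (induction b rule: dec_induct)
      case base
      have "1 \<in> {1..2*s}" "1 \<in> {1..2*t}" using pos by auto
      then show ?case using P[rule_format, of "q 1" "p 1"] pD qD qp base by auto
    next
      case (step b)
      then have "P (q (Suc b)) = P (q b)"
        using P[rule_format, of "q (Suc b)" "q b"] qD[of b] qD[of "Suc b"] qq[of "Suc b" b] by auto
      with step show ?case by simp
    qed
    have r: "P (r (2*u)) = P (p 1)"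
    proof -
      have "2*s \<in> {1..2*s}" "2*u \<in> {1..2*u}" using pos by auto
      then have "P (r (2*u)) = P (p (2*s))"
        using P[rule_format, of "r (2*u)" "p (2*s)"] pD rD rp by auto
      then show ?thesis using p[of "2*s"] pos by simp
    qed
    have "x \<in> p ` {1..2*s} \<union> q ` {1..2*t} \<union> r ` {1..2*u}"
    proof -
      have "S \<subseteq> p ` {1..2*s} \<union> q ` {1..2*t} \<union> r ` {1..2*u}"
        "T \<subseteq> q ` {1..2*t} \<union> r ` {1..2*u} \<union> p ` {1..2*s}"
        unfolding S_def T_def by (rule colour_class_subset, rule rot.colour_class_subset)
      with x show ?thesis by (auto simp only:)
    qed
    then consider a where "x = p a" "a \<in> {1..2*s}" | b where "x = q b" "b \<in> {1..2*t}"
      | c where "x = r c" "c \<in> {1..2*u}" by blast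
    then show ?thesis
    proof cases
      case 1
      then show ?thesis using p[of a] by simp
    next
      case 2
      then show ?thesis using q[of b] qD[of b] x by simp
    next
      case 3
      then show ?thesis using r rD[of c] x by simp
    qed
  qed
  then show ?thesis unfolding connected_on_def by blast
qed

text \<open>In terms of monomials: the product of these two class variables is alone in its fibre.\<close>

lemma pair_of_classes_unique:
  assumes AB: "A \<in> stable_sets G" "B \<in> stable_sets G"
    and eq: "toric_exponent A + toric_exponent B =
      toric_exponent (colour_class p q r s t u) + toric_exponent (colour_class q r p t u s)"
  shows "Poly_Mapping.single A (1::nat) + Poly_Mapping.single B 1 =
    Poly_Mapping.single (colour_class p q r s t u) 1 + Poly_Mapping.single (colour_class q r p t u s) 1"
proof -
  interpret rot: embedded_stretcher G q r p t u s by (rule rotate)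
  interpret pair_graph G by (rule graph)
  let ?S = "colour_class p q r s t u" and ?T = "colour_class q r p t u s"
  have fin: "finite U" if "U \<in> stable_sets G" for U
    using that finite_subset[OF _ pair_finite_verts] by (auto simp: stable_sets_def)
  have cnt: "of_bool (x \<in> A) + of_bool (x \<in> B) = (of_bool (x \<in> ?S) + of_bool (x \<in> ?T) :: nat)" for x
    using arg_cong[OF eq, of "\<lambda>e. Poly_Mapping.lookup e (t_var x)"]
      AB colour_class_stable rot.colour_class_stable
    by (simp add: lookup_add lookup_toric_exponent fin)
  from stable_pair_unique[OF graph colour_class_stable rot.colour_class_stable AB cnt
      symmetric_difference_connected]
  show ?thesis by (auto simp: add.commute)
qed

lemma first_vertices_colour_class:
  "p 1 \<in> colour_class p q r s t u" "q 1 \<notin> colour_class p q r s t u" "r 1 \<notin> colour_class p q r s t u"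
  using colour_class_iff(1)[of 1] colour_class_iff(2)[of 1] colour_class_iff(3)[of 1] pos by auto

lemma not_generated_by_quadratic_binomials:
  "\<not> generated_by_quadratic_binomials (stable_sets G) (toric_ideal G :: ('a set, 'k::comm_ring_1) mpoly set)"
proof
  assume "generated_by_quadratic_binomials (stable_sets G) (toric_ideal G :: ('a set, 'k) mpoly set)"
  then obtain B :: "('a set, 'k) mpoly set" where B: "B \<subseteq> quadratic_binomials (stable_sets G)"
    and gen: "toric_ideal G = genideal (poly_ring (stable_sets G)) B"
    by (auto simp: generated_by_quadratic_binomials_def)
  interpret R: cring "poly_ring (stable_sets G) :: ('a set, 'k) mpoly ring" by (rule poly_ring_cring)
  interpret graph: pair_graph G by (rule graph)
  interpret e2: embedded_stretcher G q r p t u s by (rule rotate)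
  interpret e3: embedded_stretcher G r p q u s t by (rule e2.rotate)
  interpret f1: embedded_stretcher G p r q s u t by (rule reflect)
  interpret f2: embedded_stretcher G q p r t s u by (rule e2.reflect)
  interpret f3: embedded_stretcher G r q p u t s by (rule e3.reflect)
  define S1 S2 S3 where S: "S1 = colour_class p q r s t u" "S2 = colour_class q r p t u s"
    "S3 = colour_class r p q u s t"
  define T1 T2 T3 where T: "T1 = colour_class p r q s u t" "T2 = colour_class q p r t s u"
    "T3 = colour_class r q p u t s"
  define X where "X = Poly_Mapping.single S1 (1::nat) + Poly_Mapping.single S2 1 + Poly_Mapping.single S3 1"
  define Y where "Y = Poly_Mapping.single T1 (1::nat) + Poly_Mapping.single T2 1 + Poly_Mapping.single T3 1"
  have stable: "S1 \<in> stable_sets G" "S2 \<in> stable_sets G" "S3 \<in> stable_sets G"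
    "T1 \<in> stable_sets G" "T2 \<in> stable_sets G" "T3 \<in> stable_sets G"
    unfolding S T by (rule colour_class_stable e2.colour_class_stable e3.colour_class_stable
        f1.colour_class_stable f2.colour_class_stable f3.colour_class_stable)+
  have fin: "finite A" if "A \<in> stable_sets G" for A
    using that finite_subset[OF _ graph.pair_finite_verts] by (auto simp: stable_sets_def)
  have S_distinct: "S1 \<noteq> S2" "S1 \<noteq> S3" "S2 \<noteq> S3"
    using first_vertices_colour_class e2.first_vertices_colour_class
      e3.first_vertices_colour_class
    unfolding S by blast+
  have S1_new: "S1 \<noteq> T1" "S1 \<noteq> T2" "S1 \<noteq> T3"
  proof -
    \<comment> \<open>Both \<open>S1\<close> and \<open>T1\<close> contain \<open>p 1\<close>, but only \<open>T1\<close> contains the last vertex of \<open>q\<close>.\<close>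
    have "2*t \<in> {1..2*t}" using pos by auto
    from colour_class_iff(2)[OF this] f1.colour_class_iff(3)[OF this]
    show "S1 \<noteq> T1" by (auto simp: S T)
    show "S1 \<noteq> T2" "S1 \<noteq> T3"
      using first_vertices_colour_class f2.first_vertices_colour_class f3.first_vertices_colour_class
      unfolding S T by blast+
  qed
  have map_X: "toric_map (Poly_Mapping.single X (1::'k)) =
      Poly_Mapping.single (toric_exponent S1 + toric_exponent S2 + toric_exponent S3) 1"
    unfolding X_def by (simp only: toric_map_add_exponents toric_map_single_variable fin stable
        mult_single mult_1_left)
  have map_Y: "toric_map (Poly_Mapping.single Y (1::'k)) =
      Poly_Mapping.single (toric_exponent T1 + toric_exponent T2 + toric_exponent T3) 1"
    unfolding Y_def by (simp only: toric_map_add_exponents toric_map_single_variable fin stable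
        mult_single mult_1_left)
  \<comment> \<open>Both sides count, for each path, its odd positions, its even positions and its even positions
    without the last one.\<close>
  have "toric_exponent S1 + toric_exponent S2 + toric_exponent S3 =
      toric_exponent T1 + toric_exponent T2 + toric_exponent T3"
    unfolding S T toric_exponent_colour_class e2.toric_exponent_colour_class
      e3.toric_exponent_colour_class f1.toric_exponent_colour_class
      f2.toric_exponent_colour_class f3.toric_exponent_colour_class
    by (simp only: add_ac)
  then have map_eq: "toric_map (Poly_Mapping.single X (1::'k)) = toric_map (Poly_Mapping.single Y 1)"
    by (simp only: map_X map_Y)
  have keys_XY: "Poly_Mapping.keys X \<subseteq> stable_sets G" "Poly_Mapping.keys Y \<subseteq> stable_sets G"
    using stable by (auto simp: X_def Y_def in_keys_iff lookup_add lookup_single when_def split: if_splits)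
  have "Poly_Mapping.lookup X S1 \<noteq> Poly_Mapping.lookup Y S1"
    using S1_new by (simp add: X_def Y_def lookup_add lookup_single when_def)
  then have "X \<noteq> Y" by auto
  let ?f = "Poly_Mapping.single X (1::'k) - Poly_Mapping.single Y 1"
  have "Poly_Mapping.keys ?f \<subseteq> {X, Y}" by (rule keys_binomial)
  then have "?f \<in> carrier (poly_ring (stable_sets G))"
    using keys_XY by (auto simp: carrier_poly_ring)
  then have f: "?f \<in> toric_ideal G"
    by (simp add: toric_ideal_iff toric_map_diff map_eq)
  have rigid: "Poly_Mapping.single A' (1::nat) + Poly_Mapping.single B' 1 =
      Poly_Mapping.single A 1 + Poly_Mapping.single B 1"
    if AB: "A \<in> {S1, S2, S3}" "B \<in> {S1, S2, S3}" "A \<noteq> B"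
      and AB': "A' \<in> stable_sets G" "B' \<in> stable_sets G"
      and eq: "toric_exponent A' + toric_exponent B' = toric_exponent A + toric_exponent B" for A B A' B'
  proof -
    note rigid = pair_of_classes_unique[OF AB', folded S]
      e2.pair_of_classes_unique[OF AB', folded S] e3.pair_of_classes_unique[OF AB', folded S]
    from AB consider "A = S1" "B = S2" | "A = S2" "B = S1" | "A = S2" "B = S3" | "A = S3" "B = S2"
      | "A = S3" "B = S1" | "A = S1" "B = S3"
      by (elim insertE emptyE; simp)
    then show ?thesis
      using eq rigid by cases (simp_all add: add.commute)
  qed
  have "X \<notin> Poly_Mapping.keys ?f"
  proof (rule monomial_notin_keys_genideal[OF _ f[unfolded gen]])
    show carrier: "B \<subseteq> carrier (poly_ring (stable_sets G))"
      using B quadratic_binomials_in_carrier by (rule order_trans)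
    fix b m w assume b: "b \<in> B" and m: "m \<in> Poly_Mapping.keys b"
    obtain m1 m2 where b_eq: "b = Poly_Mapping.single m1 1 - Poly_Mapping.single m2 1"
      and ne: "m1 \<noteq> m2" and deg: "mono_deg m1 = 2" "mono_deg m2 = 2"
      and keys: "Poly_Mapping.keys m1 \<subseteq> stable_sets G" "Poly_Mapping.keys m2 \<subseteq> stable_sets G"
      using B b by (auto simp: quadratic_binomials_def)
    have "b \<in> toric_ideal G" using R.genideal_self[OF carrier] b by (auto simp: gen)
    then have eq: "toric_map (Poly_Mapping.single m1 (1::'k)) = toric_map (Poly_Mapping.single m2 1)"
      by (simp add: toric_ideal_iff b_eq toric_map_diff)
    have "m \<in> {m1, m2}" using m keys_binomial unfolding b_eq by (rule subsetD[rotated])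
    \<comment> \<open>\<open>m'\<close> is the other term of the binomial.\<close>
    then obtain m' where m': "{m, m'} = {m1, m2}" by blast
    have md: "mono_deg m = 2" "mono_deg m' = 2" "m \<noteq> m'" "Poly_Mapping.keys m \<subseteq> stable_sets G"
      "Poly_Mapping.keys m' \<subseteq> stable_sets G"
      "toric_map (Poly_Mapping.single m (1::'k)) = toric_map (Poly_Mapping.single m' 1)"
      using m' deg ne keys eq by (auto simp: doubleton_eq_iff)
    obtain A1 A2 where m_eq: "m = Poly_Mapping.single A1 1 + Poly_Mapping.single A2 1"
      using md(1) by (rule quadratic_monomialE)
    obtain B1 B2 where m'_eq: "m' = Poly_Mapping.single B1 1 + Poly_Mapping.single B2 1"
      using md(2) by (rule quadratic_monomialE)
    have st: "A1 \<in> stable_sets G" "A2 \<in> stable_sets G" "B1 \<in> stable_sets G" "B2 \<in> stable_sets G"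
      using md(4,5) by (auto simp: m_eq m'_eq subset_iff in_keys_iff lookup_add lookup_single)
    have "Poly_Mapping.single (toric_exponent A1 + toric_exponent A2) (1::'k) =
        Poly_Mapping.single (toric_exponent B1 + toric_exponent B2) 1"
      using md(6) unfolding m_eq m'_eq
      by (simp only: toric_map_add_exponents toric_map_single_variable fin st mult_single mult_1_left)
    then have exps: "toric_exponent B1 + toric_exponent B2 = toric_exponent A1 + toric_exponent A2"
      by (metis lookup_single_eq lookup_single_not_eq one_neq_zero)
    show "m + w \<noteq> X"
    proof
      assume "m + w = X"
      then have "A1 \<in> {S1, S2, S3}" "A2 \<in> {S1, S2, S3}" "A1 \<noteq> A2"
        unfolding m_eq X_def by (rule squarefree_divisor_of_degree_2[OF S_distinct])+
      then have "m' = m" unfolding m_eq m'_eq using st exps by (intro rigid) auto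
      with md(3) show False by simp
    qed
  qed
  moreover have "X \<in> Poly_Mapping.keys ?f"
    using \<open>X \<noteq> Y\<close> by (simp add: in_keys_iff lookup_minus lookup_single when_def)
  ultimately show False by contradiction
qed

end

section \<open>Induced subgraphs isomorphic to a stretcher\<close>

text \<open>
  The vertex map of the isomorphism goes from \<open>H\<close> to \<open>K\<close>; its inverse embeds \<open>K\<close> into \<open>G\<close>, keeping
  edges and non-edges.
\<close>

lemma induced_isomorphic_copy:
  assumes sub: "induced_subgraph H (with_proj G)" and iso: "digraph_iso H (with_proj K)"
  obtains f where "inj_on f (pverts K)" "f ` pverts K \<subseteq> pverts G"
    "\<And>x y. x \<in> pverts K \<Longrightarrow> y \<in> pverts K \<Longrightarrow> (f x, f y) \<in> parcs G \<longleftrightarrow> (x, y) \<in> parcs K"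
proof -
  have H: "verts H \<subseteq> pverts G" "tail H = fst" "head H = snd"
    "arcs H = {e \<in> parcs G. fst e \<in> verts H \<and> snd e \<in> verts H}"
    using sub by (auto simp: induced_subgraph_def subgraph_def compatible_def)
  obtain h where h: "pre_digraph.digraph_isomorphism H h" "with_proj K = app_iso h H"
    using iso by (auto simp: digraph_iso_def)
  let ?h = "iso_verts h"
  have inj: "inj_on ?h (verts H)"
    and ends: "\<And>e. e \<in> arcs H \<Longrightarrow> ?h (fst e) = iso_tail h (iso_arcs h e) \<and>
      ?h (snd e) = iso_head h (iso_arcs h e)"
    using h(1) H by (auto simp: pre_digraph.digraph_isomorphism_def)
  have K: "pverts K = ?h ` verts H" "parcs K = iso_arcs h ` arcs H"
    "iso_tail h = fst" "iso_head h = snd"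
    using h(2) by (auto simp: with_proj_def app_iso_def)
  have arc: "iso_arcs h e = (?h (fst e), ?h (snd e))" if "e \<in> arcs H" for e
    using ends[OF that] by (simp add: K)
  have arcs_iff: "(?h x, ?h y) \<in> parcs K \<longleftrightarrow> (x, y) \<in> parcs G" if "x \<in> verts H" "y \<in> verts H" for x y
  proof
    assume "(x, y) \<in> parcs G"
    then have "(x, y) \<in> arcs H" using that by (simp add: H(4))
    then show "(?h x, ?h y) \<in> parcs K" using arc[of "(x, y)"] by (force simp: K(2))
  next
    assume "(?h x, ?h y) \<in> parcs K"
    then obtain e where e: "e \<in> arcs H" "?h x = ?h (fst e)" "?h y = ?h (snd e)"
      using arc by (auto simp: K(2))
    then have "e = (x, y)"
      using inj that by (auto simp: H(4) inj_on_def prod_eq_iff)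
    with e show "(x, y) \<in> parcs G" by (simp add: H(4))
  qed
  let ?f = "the_inv_into (verts H) ?h"
  have f: "?f x \<in> verts H" "?h (?f x) = x" if "x \<in> pverts K" for x
    using that inj by (auto simp: K the_inv_into_f_f)
  show ?thesis
  proof (rule that[of ?f])
    show "inj_on ?f (pverts K)" by (metis f(2) inj_onI)
    show "?f ` pverts K \<subseteq> pverts G" using f(1) H(1) by blast
    show "(?f x, ?f y) \<in> parcs G \<longleftrightarrow> (x, y) \<in> parcs K" if "x \<in> pverts K" "y \<in> pverts K" for x y
      using arcs_iff[of "?f x" "?f y"] f that by simp
  qed
qed

lemma embedded_stretcherI:
  fixes G :: "'a pair_pre_digraph"
  assumes graph: "pair_graph G" and pos: "s \<ge> 1" "t \<ge> 1" "u \<ge> 1"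
    and inj: "inj_on f (pverts (odd_stretcher s t u))"
    and verts: "f ` pverts (odd_stretcher s t u) \<subseteq> pverts G"
    and arcs: "\<And>x y. x \<in> pverts (odd_stretcher s t u) \<Longrightarrow> y \<in> pverts (odd_stretcher s t u) \<Longrightarrow>
      (f x, f y) \<in> parcs G \<longleftrightarrow> (x, y) \<in> parcs (odd_stretcher s t u)"
  shows "embedded_stretcher G (f \<circ> vi) (f \<circ> vj) (f \<circ> vk) s t u"
proof -
  let ?K = "odd_stretcher s t u"
  have K: "pverts ?K = vi ` {1..2*s} \<union> vj ` {1..2*t} \<union> vk ` {1..2*u}"
    by (simp add: odd_stretcher_def Let_def)
  have f_eq: "f x = f y \<longleftrightarrow> x = y" if "x \<in> pverts ?K" "y \<in> pverts ?K" for x y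
    using inj that by (auto simp: inj_on_def)
  show ?thesis
  proof (rule embedded_stretcher.intro[OF graph pos])
    show "(f \<circ> vi) ` {1..2*s} \<subseteq> pverts G" "(f \<circ> vj) ` {1..2*t} \<subseteq> pverts G"
      "(f \<circ> vk) ` {1..2*u} \<subseteq> pverts G"
      using verts by (auto simp: K)
    show "inj_on (f \<circ> vi) {1..2*s}" "inj_on (f \<circ> vj) {1..2*t}" "inj_on (f \<circ> vk) {1..2*u}"
      by (rule inj_onI; simp add: f_eq K)+
    show "(f \<circ> vi) ` {1..2*s} \<inter> (f \<circ> vj) ` {1..2*t} = {}"
      "(f \<circ> vj) ` {1..2*t} \<inter> (f \<circ> vk) ` {1..2*u} = {}"
      "(f \<circ> vk) ` {1..2*u} \<inter> (f \<circ> vi) ` {1..2*s} = {}"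
      using f_eq by (auto simp: K)
    fix a b
    show "((f \<circ> vi) a, (f \<circ> vi) b) \<in> parcs G \<longleftrightarrow> b = a + 1 \<or> a = b + 1"
      if "a \<in> {1..2*s}" "b \<in> {1..2*s}"
      using that by (auto simp: arcs K odd_stretcher_def Let_def)
    show "((f \<circ> vj) a, (f \<circ> vj) b) \<in> parcs G \<longleftrightarrow> b = a + 1 \<or> a = b + 1"
      if "a \<in> {1..2*t}" "b \<in> {1..2*t}"
      using that by (auto simp: arcs K odd_stretcher_def Let_def)
    show "((f \<circ> vk) a, (f \<circ> vk) b) \<in> parcs G \<longleftrightarrow> b = a + 1 \<or> a = b + 1"
      if "a \<in> {1..2*u}" "b \<in> {1..2*u}"
      using that by (auto simp: arcs K odd_stretcher_def Let_def)
    show "((f \<circ> vi) a, (f \<circ> vj) b) \<in> parcs G \<longleftrightarrow> a = 1 \<and> b = 1 \<or> a = 2*s \<and> b = 2*t"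
      if "a \<in> {1..2*s}" "b \<in> {1..2*t}"
      using that by (auto simp: arcs K odd_stretcher_def Let_def)
    show "((f \<circ> vj) a, (f \<circ> vk) b) \<in> parcs G \<longleftrightarrow> a = 1 \<and> b = 1 \<or> a = 2*t \<and> b = 2*u"
      if "a \<in> {1..2*t}" "b \<in> {1..2*u}"
      using that by (auto simp: arcs K odd_stretcher_def Let_def)
    show "((f \<circ> vk) a, (f \<circ> vi) b) \<in> parcs G \<longleftrightarrow> a = 1 \<and> b = 1 \<or> a = 2*u \<and> b = 2*s"
      if "a \<in> {1..2*u}" "b \<in> {1..2*s}"
      using that by (auto simp: arcs K odd_stretcher_def Let_def)
  qed
qed

theorem theorem1p7:
  fixes G :: "nat pair_pre_digraph" and n :: nat
  assumes "pair_graph G"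
    and "pverts G = {1..n}"
    and "generated_by_quadratic_binomials (stable_sets G)
           (toric_ideal G :: (nat set, 'k::field) mpoly set)"
  shows "\<forall>s t u. s \<ge> 1 \<and> t \<ge> 1 \<and> u \<ge> 1 \<longrightarrow>
           \<not> (\<exists>H. induced_subgraph H (with_proj G) \<and>
                  digraph_iso H (with_proj (odd_stretcher s t u)))"
proof (intro allI impI notI, elim exE conjE)
  fix s t u H
  assume pos: "1 \<le> s" "1 \<le> t" "1 \<le> u"
    and H: "induced_subgraph H (with_proj G)" "digraph_iso H (with_proj (odd_stretcher s t u))"
  obtain f where "inj_on f (pverts (odd_stretcher s t u))"
    "f ` pverts (odd_stretcher s t u) \<subseteq> pverts G"
    "\<And>x y. x \<in> pverts (odd_stretcher s t u) \<Longrightarrow> y \<in> pverts (odd_stretcher s t u) \<Longrightarrow>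
      (f x, f y) \<in> parcs G \<longleftrightarrow> (x, y) \<in> parcs (odd_stretcher s t u)"
    using induced_isomorphic_copy[OF H] by blast
  then have "embedded_stretcher G (f \<circ> vi) (f \<circ> vj) (f \<circ> vk) s t u"
    by (rule embedded_stretcherI[OF assms(1) pos])
  from embedded_stretcher.not_generated_by_quadratic_binomials[OF this] assms(3)
  show False by blast
qed

end
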